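(* Let $G=P_1\,\Box\,P_2$ be a simple grid graph, with $P_1,P_2$ paths of lengths $n_1,n_2$, where $n_\ell=2^{n_{\ell,0}}\prod_{\nu=1}^{k_\ell}p_{\ell,\nu}$ ($\ell\in\{1,2\}$) is a prime factorization with $k_\ell\ge 1$ and odd primes $p_{\ell,1},\dots,p_{\ell,k_\ell}$. Let $I_s=\{i_1,\dots,i_m\}$ be a set of control (respectively, observation) nodes with controllability (respectively, observability) partition $O_1,\dots,O_m$. Then $G$ is controllable (respectively, observable) from $I_s$ if and only if $O_1\cap\cdots\cap O_m=\emptyset$.
   Context: The path graph of length $n$ has node set $\{1,\dots,n\}$ and edges $(i,i+1)$, $1\le i\le n-1$. The Laplacian of a graph is $L=D-A$. The grid $P_1\Box P_2$ is the Cartesian product; its nodes are $[(i)_1,(i)_2]$ with $(i)_\ell\in\{1,\dots,n_\ell\}$. The grid is simple if all sums $\lambda+\lambda'$, with $\lambda$ a Laplacian eigenvalue of $P_1$ and $\lambda'$ a Laplacian eigenvalue of $P_2$, are pairwise distinct. For a set of nodes $\{i_1,\dots,i_m\}$ let $B=[e_{i_1}|\cdots|e_{i_m}]$ and $C=B^T$. The graph is controllable (observable) from this set if the pair $(L,B)$ is controllable (the pair $(L,C)$ is observable). Controllability (observability) partition: write each node of $I_s$ as $i_\alpha=[(i_\alpha)_1,(i_\alpha)_2]$. Say that $i_\alpha$ satisfies the condition for the odd prime $p\mid n_\ell$ along direction $\ell$ if $n_\ell-(i_\alpha)_\ell\equiv (i_\alpha)_\ell-1 \pmod p$. Then $O_\alpha$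 is the set of all pairs $[p_{1,\nu},p_{2,\mu}]$, $\nu\in\{1,\dots,k_1\}$, $\mu\in\{1,\dots,k_2\}$, such that $i_\alpha$ satisfies the condition for $p_{1,\nu}$ along direction $1$ or satisfies the condition for $p_{2,\mu}$ along direction $2$ (or both). The intersection is the ordinary intersection of sets of pairs. *)

theory Defs
  imports
    Complex_Main
    "HOL-Number_Theory.Cong"
    "HOL-Computational_Algebra.Primes"
    "Jordan_Normal_Form.DL_Rank"
    "Jordan_Normal_Form.Spectral_Radius"
begin

text \<open>
  Vertices are kept as a duplicate-free list, whose order fixes the row and column
  indices of all matrices attached to the graph. The relation \<open>adj\<close> is meant to be
  symmetric and is only relevant between listed vertices.
\<close>

record 'a fin_graph =
  nodes :: "'a list"
  adj :: "'a \<Rightarrow> 'a \<Rightarrow> bool"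

definition path_graph :: "nat \<Rightarrow> nat fin_graph" where
  "path_graph n = \<lparr> nodes = [1..<n + 1],
     adj = (\<lambda>i j. i \<in> {1..n} \<and> j \<in> {1..n} \<and> (j = i + 1 \<or> i = j + 1)) \<rparr>"

definition cart_product :: "'a fin_graph \<Rightarrow> 'b fin_graph \<Rightarrow> ('a \<times> 'b) fin_graph"
    (infixr "\<box>" 70) where
  "G \<box> H = \<lparr> nodes = List.product (nodes G) (nodes H),
     adj = (\<lambda>(u, v) (u', v'). (u = u' \<and> adj H v v') \<or> (adj G u u' \<and> v = v')) \<rparr>"

definition num_nodes :: "'a fin_graph \<Rightarrow> nat" where
  "num_nodes G = length (nodes G)"

definition degree_of :: "'a fin_graph \<Rightarrow> 'a \<Rightarrow> nat" where
  "degree_of G v = card {w \<in> set (nodes G). adj G v w}"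

definition adjacency_matrix :: "'a fin_graph \<Rightarrow> real mat" where
  "adjacency_matrix G = mat (num_nodes G) (num_nodes G)
     (\<lambda>(r, c). if adj G (nodes G ! r) (nodes G ! c) then 1 else 0)"

definition degree_matrix :: "'a fin_graph \<Rightarrow> real mat" where
  "degree_matrix G = mat_diag (num_nodes G) (\<lambda>r. real (degree_of G (nodes G ! r)))"

definition laplacian :: "'a fin_graph \<Rightarrow> real mat" where
  "laplacian G = degree_matrix G - adjacency_matrix G"

text \<open>
  The spectra are taken as sets; the Laplacian of a path has no multiple eigenvalue,
  so counting multiplicities would make no difference.
\<close>

definition simple_grid :: "nat \<Rightarrow> nat \<Rightarrow> bool" where
  "simple_grid n1 n2 \<longleftrightarrow>
     inj_on (\<lambda>(x, y). x + y)
       (spectrum (laplacian (path_graph n1)) \<times> spectrum (laplacian (path_graph n2)))"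

text \<open>
  The controllability matrix \<open>[B | A B | \<dots> | A\<^sup>n\<^sup>-\<^sup>1 B]\<close> and the observability
  matrix, which stacks \<open>C, C A, \<dots>, C A\<^sup>n\<^sup>-\<^sup>1\<close>; a pair is controllable (observable)
  if the corresponding matrix has full rank \<open>n\<close>.
\<close>

definition controllability_matrix :: "real mat \<Rightarrow> real mat \<Rightarrow> real mat" where
  "controllability_matrix A B = mat (dim_row A) (dim_row A * dim_col B)
     (\<lambda>(r, c). (A ^\<^sub>m (c div dim_col B) * B) $$ (r, c mod dim_col B))"

definition observability_matrix :: "real mat \<Rightarrow> real mat \<Rightarrow> real mat" where
  "observability_matrix A C = mat (dim_row A * dim_row C) (dim_row A)
     (\<lambda>(r, c). (C * A ^\<^sub>m (r div dim_row C)) $$ (r mod dim_row C, c))"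

definition controllable_pair :: "real mat \<Rightarrow> real mat \<Rightarrow> bool" where
  "controllable_pair A B \<longleftrightarrow>
     vec_space.rank (dim_row A) (controllability_matrix A B) = dim_row A"

definition observable_pair :: "real mat \<Rightarrow> real mat \<Rightarrow> bool" where
  "observable_pair A C \<longleftrightarrow>
     vec_space.rank (dim_row A * dim_row C) (observability_matrix A C) = dim_row A"

text \<open>
  The nodes \<open>i 1, \<dots>, i m\<close> are numbered from 1, matrix columns from 0.
\<close>

definition node_matrix :: "'a fin_graph \<Rightarrow> nat \<Rightarrow> (nat \<Rightarrow> 'a) \<Rightarrow> real mat" where
  "node_matrix G m i = mat (num_nodes G) m
     (\<lambda>(r, c). if nodes G ! r = i (c + 1) then 1 else 0)"

definition controllable_from :: "'a fin_graph \<Rightarrow> nat \<Rightarrow> (nat \<Rightarrow> 'a) \<Rightarrow> bool" where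
  "controllable_from G m i \<longleftrightarrow> controllable_pair (laplacian G) (node_matrix G m i)"

definition observable_from :: "'a fin_graph \<Rightarrow> nat \<Rightarrow> (nat \<Rightarrow> 'a) \<Rightarrow> bool" where
  "observable_from G m i \<longleftrightarrow> observable_pair (laplacian G) (transpose_mat (node_matrix G m i))"

definition prime_condition :: "nat \<Rightarrow> nat \<Rightarrow> nat \<Rightarrow> bool" where
  "prime_condition n j p \<longleftrightarrow> [int n - int j = int j - 1] (mod int p)"

definition partition_block ::
    "nat \<Rightarrow> nat \<Rightarrow> nat \<Rightarrow> nat \<Rightarrow> (nat \<Rightarrow> nat) \<Rightarrow> (nat \<Rightarrow> nat) \<Rightarrow> nat \<times> nat \<Rightarrow> (nat \<times> nat) set" where
  "partition_block n1 n2 k1 k2 p1 p2 v =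
     {(p1 \<nu>, p2 \<mu>) | \<nu> \<mu>. \<nu> \<in> {1..k1} \<and> \<mu> \<in> {1..k2} \<and>
        (prime_condition n1 (fst v) (p1 \<nu>) \<or> prime_condition n2 (snd v) (p2 \<mu>))}"

end

(* Since the grid is simple, the products of the cosine eigenvectors of the two paths have distinct
   eigenvalues, so by the eigenvector test (Popov-Belevitch-Hautus) the grid is controllable,
   equivalently observable, iff no product of modes k of P1 and l of P2 vanishes at every selected
   node. Mode k of a path of length n vanishes at j iff k (2j - 1) is an odd multiple of n. Hence
   mode n/p, for an odd prime p dividing n, vanishes exactly where p divides 2j - 1, which is the
   prime condition, and the zero set of any mode is contained in that of some mode n/p.
   A product of modes vanishing on all nodes therefore exists iff a pair of primes lies in all the
   partition blocks. *)
theory Submission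
  imports Defs
begin

section \<open>Rank, controllability and eigenvectors\<close>

text \<open>Rank is computed from the set of columns, so linear independence settles only the case
  of distinct columns. A repeated column puts a difference of unit vectors into the kernel and
  leaves fewer than \<open>nc\<close> distinct columns.\<close>

lemma (in vec_space) rank_eq_ncols_iff:
  assumes A: "A \<in> carrier_mat n nc"
  shows "rank A = nc \<longleftrightarrow> (\<forall>v\<in>carrier_vec nc. A *\<^sub>v v = 0\<^sub>v n \<longrightarrow> v = 0\<^sub>v nc)"
proof (cases "distinct (cols A)")
  case True
  have "rank A = nc \<longleftrightarrow> lin_indpt (set (cols A))"
    using lin_indpt_full_rank[OF A True] full_rank_lin_indpt[OF A _ True] by blast
  also have "\<dots> \<longleftrightarrow> (\<forall>v\<in>carrier_vec nc. A *\<^sub>v v = 0\<^sub>v n \<longrightarrow> v = 0\<^sub>v nc)"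
    using lin_depI[OF A _ _ _ True] lin_depE[OF A _ True] by blast
  finally show ?thesis .
next
  case False
  obtain S where S: "maximal S (\<lambda>T. T \<subseteq> set (cols A) \<and> lin_indpt T)"
    using maximal_exists[of "(\<lambda>T. T \<subseteq> set (cols A) \<and> lin_indpt T)" "card (set (cols A))" "{}"]
    by (meson List.finite_set card_mono empty_iff empty_subsetI finite_lin_indpt2 rev_finite_subset)
  have "card S \<le> card (set (cols A))"
    using S by (simp add: card_mono maximal_def)
  also have "\<dots> < nc"
    using False A by (metis card_distinct card_length carrier_matD(2) cols_length le_neq_implies_less)
  finally have "rank A \<noteq> nc"
    using rank_card_indpt[OF A S] by simp
  moreover obtain i j where ij: "i < nc" "j < nc" "i \<noteq> j" "col A i = col A j"
    using False A by (auto simp: distinct_conv_nth)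
  moreover have "A *\<^sub>v (unit_vec nc i - unit_vec nc j) = 0\<^sub>v n"
  proof -
    have unit: "A *\<^sub>v unit_vec nc j = col A j" if "j < nc" for j
      using A that by (intro eq_vecI) auto
    show ?thesis
      using A ij by (subst mult_minus_distrib_mat_vec[OF A]) (auto simp: unit)
  qed
  moreover have "unit_vec nc i - unit_vec nc j \<noteq> (0\<^sub>v nc :: 'a vec)"
  proof
    assume "unit_vec nc i - unit_vec nc j = (0\<^sub>v nc :: 'a vec)"
    then have "(unit_vec nc i - unit_vec nc j) $ i = (0\<^sub>v nc :: 'a vec) $ i" by simp
    then show False using ij by simp
  qed
  ultimately show ?thesis
    by (metis minus_carrier_vec unit_vec_carrier)
qed

lemma real_scalar_prod_self_eq_0_iff:
  fixes x :: "real vec"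
  assumes "x \<in> carrier_vec n"
  shows "x \<bullet> x = 0 \<longleftrightarrow> x = 0\<^sub>v n"
  using conjugate_square_eq_0_vec[OF assms] by simp

text \<open>The Gram matrix \<open>A A\<^sup>T\<close> has the same kernel as \<open>A\<^sup>T\<close>; when it is
  invertible, \<open>A\<close> is surjective.\<close>

lemma rank_eq_nrows_iff:
  fixes A :: "real mat"
  assumes A: "A \<in> carrier_mat n nc"
  shows "vec_space.rank n A = n \<longleftrightarrow>
    (\<forall>x\<in>carrier_vec n. A\<^sup>T *\<^sub>v x = 0\<^sub>v nc \<longrightarrow> x = 0\<^sub>v n)"
proof -
  interpret vec_space "TYPE(real)" n .
  have colsC: "set (cols A) \<subseteq> carrier_vec n"
    using A cols_dim by blast
  show ?thesis
  proof (intro iffI ballI impI)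
    fix x assume r: "rank A = n" and x: "x \<in> carrier_vec n" and Ax: "A\<^sup>T *\<^sub>v x = 0\<^sub>v nc"
    obtain S where S: "maximal S (\<lambda>T. T \<subseteq> set (cols A) \<and> lin_indpt T)"
      using maximal_exists[of "(\<lambda>T. T \<subseteq> set (cols A) \<and> lin_indpt T)" "card (set (cols A))" "{}"]
      by (meson List.finite_set card_mono empty_iff empty_subsetI finite_lin_indpt2 rev_finite_subset)
    have "card S = n" using rank_card_indpt[OF A S] r by simp
    moreover have "S \<subseteq> set (cols A)" "lin_indpt S" using S by (auto simp: maximal_def)
    ultimately have "basis S"
      using dim_li_is_basis[of S] colsC dim_is_n fin_dim
      by (auto intro: finite_subset)
    then have "span S = carrier_vec n" by (simp add: basis_def)
    then have "x \<in> span (set (cols A))"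
      using span_is_monotone[OF \<open>S \<subseteq> set (cols A)\<close>] x by auto
    then obtain y where y: "y \<in> carrier_vec nc" "A *\<^sub>v y = x"
      using col_space_eq[OF A] A by (auto simp: col_space_def)
    \<comment> \<open>\<open>x\<close> lies in the column space of \<open>A\<close> and in the
      kernel of its transpose, which are orthogonal.\<close>
    have "x \<bullet> x = (A\<^sup>T *\<^sub>v x) \<bullet> y"
      using transpose_vec_mult_scalar[OF A y(1) x] y(2) by simp
    then show "x = 0\<^sub>v n"
      using real_scalar_prod_self_eq_0_iff[OF x] Ax y(1) by simp
  next
    assume ker: "\<forall>x\<in>carrier_vec n. A\<^sup>T *\<^sub>v x = 0\<^sub>v nc \<longrightarrow> x = 0\<^sub>v n"
    have G: "A * A\<^sup>T \<in> carrier_mat n n" using A by simp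
    have "det (A * A\<^sup>T) \<noteq> 0"
    proof
      assume "det (A * A\<^sup>T) = 0"
      then obtain v where v: "v \<in> carrier_vec n" "v \<noteq> 0\<^sub>v n" "(A * A\<^sup>T) *\<^sub>v v = 0\<^sub>v n"
        using det_0_iff_vec_prod_zero[OF G] by auto
      have Av: "A\<^sup>T *\<^sub>v v \<in> carrier_vec nc" using A v(1) by simp
      have "(A\<^sup>T *\<^sub>v v) \<bullet> (A\<^sup>T *\<^sub>v v) = v \<bullet> (A *\<^sub>v (A\<^sup>T *\<^sub>v v))"
        by (rule transpose_vec_mult_scalar[OF A Av v(1)])
      also have "A *\<^sub>v (A\<^sup>T *\<^sub>v v) = 0\<^sub>v n"
        using v(1,3) A by (subst assoc_mult_mat_vec[symmetric, of _ n nc _ n]) auto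
      finally show False
        using real_scalar_prod_self_eq_0_iff[OF Av] ker v by simp
    qed
    have "carrier_vec n \<subseteq> col_space A"
    proof
      fix w :: "real vec" assume w: "w \<in> carrier_vec n"
      obtain H where H: "H \<in> carrier_mat n n" "(A * A\<^sup>T) * H = 1\<^sub>m n"
        using det_non_zero_imp_unit[OF G \<open>det (A * A\<^sup>T) \<noteq> 0\<close>, where b="()"]
        by (auto simp: Units_def ring_mat_def)
      have "A *\<^sub>v (A\<^sup>T *\<^sub>v (H *\<^sub>v w)) = (A * A\<^sup>T) *\<^sub>v (H *\<^sub>v w)"
        using A H w by (intro assoc_mult_mat_vec[symmetric]) auto
      also have "\<dots> = ((A * A\<^sup>T) * H) *\<^sub>v w"
        by (rule assoc_mult_mat_vec[symmetric, OF G H(1) w])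
      finally have "A *\<^sub>v (A\<^sup>T *\<^sub>v (H *\<^sub>v w)) = w" using H w by simp
      moreover have "A\<^sup>T *\<^sub>v (H *\<^sub>v w) \<in> carrier_vec nc" using A H w by simp
      ultimately show "w \<in> col_space A" using col_space_eq[OF A] A w by auto
    qed
    then have "span (set (cols A)) = carrier_vec n"
      using colsC by (auto simp: col_space_def)
    then show "rank A = n"
      unfolding rank_def using dim_is_n by (simp add: module_vec_def)
  qed
qed

section \<open>Controllability and observability as one kernel condition\<close>

lemma symmetric_pow_mat:
  fixes A :: "'a :: comm_semiring_1 mat"
  assumes A: "A \<in> carrier_mat n n" and sym: "A\<^sup>T = A"
  shows "(A ^\<^sub>m k)\<^sup>T = A ^\<^sub>m k"
proof (induction k)
  case (Suc k)
  have P: "A ^\<^sub>m k \<in> carrier_mat n n" using A by simp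
  \<comment> \<open>Powers grow by a factor on the right, which transposition moves to the
    left.\<close>
  have "A * A ^\<^sub>m k = A ^\<^sub>m k * A"
  proof (induction k)
    case (Suc k)
    then show ?case 
      using assoc_mult_mat[OF A pow_carrier_mat[OF A, of k] A] by simp
  qed (use A in simp)
  then show ?case
    using transpose_mult[OF P A] Suc sym by simp
qed (use A in simp)

text \<open>Membership in the kernel of the observability matrix of \<open>A\<close> and
  \<open>B\<^sup>T\<close>, free of the block layout; for symmetric \<open>A\<close> also in the
  left kernel of the controllability matrix.\<close>

definition unobservable_vec :: "real mat \<Rightarrow> real mat \<Rightarrow> real vec \<Rightarrow> bool" where
  "unobservable_vec A B x \<longleftrightarrow>
     (\<forall>k<dim_row A. \<forall>c<dim_col B. col B c \<bullet> (A ^\<^sub>m k *\<^sub>v x) = 0)"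

lemma ex_block_index:
  fixes m :: nat
  assumes "k < n" "c < m"
  shows "\<exists>r<n * m. r div m = k \<and> r mod m = c"
proof (intro exI conjI)
  have "k * m + c < Suc k * m" using assms by simp
  also have "\<dots> \<le> n * m" using assms by (intro mult_le_mono1) simp
  finally show "k * m + c < n * m" .
qed (use assms in auto)

lemma block_vec_eq_0_iff:
  assumes "\<And>r. r < n * m \<Longrightarrow> v $ r = f (r div m) (r mod m)" and "v \<in> carrier_vec (n * m)"
  shows "v = 0\<^sub>v (n * m) \<longleftrightarrow> (\<forall>k<n. \<forall>c<m. f k c = 0)"
proof
  assume v: "v = 0\<^sub>v (n * m)"
  show "\<forall>k<n. \<forall>c<m. f k c = 0"
  proof (intro allI impI)
    fix k c assume "k < n" "c < m"
    then obtain r where "r < n * m" "r div m = k" "r mod m = c"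
      using ex_block_index by metis
    then show "f k c = 0" using assms(1)[of r] v by simp
  qed
next
  assume *: "\<forall>k<n. \<forall>c<m. f k c = 0"
  have "r div m < n \<and> r mod m < m" if "r < n * m" for r
    using that by (cases "m = 0") (auto simp: less_mult_imp_div_less)
  then show "v = 0\<^sub>v (n * m)"
    using assms * by (intro eq_vecI) auto
qed

text \<open>Full row rank means that the transpose has trivial kernel. Each column of the
  controllability matrix is a power of \<open>A\<close> applied to a column of \<open>B\<close>, and
  symmetry moves that power onto \<open>x\<close>.\<close>

lemma controllable_pair_iff:
  assumes A: "A \<in> carrier_mat n n" and sym: "A\<^sup>T = A" and B: "B \<in> carrier_mat n m"
  shows "controllable_pair A B \<longleftrightarrow> (\<forall>x\<in>carrier_vec n. unobservable_vec A B x \<longrightarrow> x = 0\<^sub>v n)"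
proof -
  let ?K = "controllability_matrix A B"
  have K: "?K \<in> carrier_mat n (n * m)"
    using A B by (simp add: controllability_matrix_def)
  have "?K\<^sup>T *\<^sub>v x = 0\<^sub>v (n * m) \<longleftrightarrow> unobservable_vec A B x" if x: "x \<in> carrier_vec n" for x
  proof -
    have "(?K\<^sup>T *\<^sub>v x) $ r = col B (r mod m) \<bullet> (A ^\<^sub>m (r div m) *\<^sub>v x)" if r: "r < n * m" for r
    proof -
      let ?P = "A ^\<^sub>m (r div m)"
      have P: "?P \<in> carrier_mat n n" using A by simp
      have c: "r mod m < m" using r by (cases "m = 0") auto
      have b: "col B (r mod m) \<in> carrier_vec n" using B c by auto
      have "col ?K r = ?P *\<^sub>v col B (r mod m)"
        using A B P c r by (intro eq_vecI) (auto simp: controllability_matrix_def)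
      then have "(?K\<^sup>T *\<^sub>v x) $ r = (?P *\<^sub>v col B (r mod m)) \<bullet> x"
        using K r by simp
      also have "\<dots> = col B (r mod m) \<bullet> (?P *\<^sub>v x)"
        using transpose_vec_mult_scalar[OF P x b] symmetric_pow_mat[OF A sym] by simp
      finally show ?thesis .
    qed
    then show ?thesis
      using A B K x unfolding unobservable_vec_def by (subst block_vec_eq_0_iff) auto
  qed
  then show ?thesis
    using rank_eq_nrows_iff[OF K] A by (simp add: controllable_pair_def)
qed

text \<open>Full rank is here the number of columns, so the kernel of the matrix itself counts; its
  row \<open>r\<close> combines the power \<open>r div m\<close> of \<open>A\<close> with column
  \<open>r mod m\<close> of \<open>B\<close>.\<close>

lemma observable_pair_iff:
  assumes A: "A \<in> carrier_mat n n" and B: "B \<in> carrier_mat n m"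
  shows "observable_pair A B\<^sup>T \<longleftrightarrow> (\<forall>x\<in>carrier_vec n. unobservable_vec A B x \<longrightarrow> x = 0\<^sub>v n)"
proof -
  let ?O = "observability_matrix A B\<^sup>T"
  have O: "?O \<in> carrier_mat (n * m) n"
    using A B by (simp add: observability_matrix_def)
  have "?O *\<^sub>v x = 0\<^sub>v (n * m) \<longleftrightarrow> unobservable_vec A B x" if x: "x \<in> carrier_vec n" for x
  proof -
    have "(?O *\<^sub>v x) $ r = col B (r mod m) \<bullet> (A ^\<^sub>m (r div m) *\<^sub>v x)" if r: "r < n * m" for r
    proof -
      let ?P = "A ^\<^sub>m (r div m)"
      have P: "?P \<in> carrier_mat n n" using A by simp
      have c: "r mod m < m" using r by (cases "m = 0") auto
      have "row ?O r = row (B\<^sup>T * ?P) (r mod m)"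
        using A B c r carrier_matD[OF P]
        by (intro eq_vecI) (simp_all add: observability_matrix_def del: pow_mat_dim_square)
      then have "(?O *\<^sub>v x) $ r = ((B\<^sup>T * ?P) *\<^sub>v x) $ (r mod m)"
        using O B r c by simp
      also have "(B\<^sup>T * ?P) *\<^sub>v x = B\<^sup>T *\<^sub>v (?P *\<^sub>v x)"
        using B P x by (intro assoc_mult_mat_vec) auto
      finally show ?thesis using B c by simp
    qed
    then show ?thesis
      using A B O x unfolding unobservable_vec_def by (subst block_vec_eq_0_iff) auto
  qed
  then show ?thesis
    using vec_space.rank_eq_ncols_iff[OF O] A B by (simp add: observable_pair_def)
qed

section \<open>The eigenvector test for a simple spectrum\<close>

text \<open>Vandermonde invertibility for distinct \<open>l j\<close>, used below to separate the
  eigencomponents of a vector.\<close>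

lemma power_sums_eq_0_imp:
  fixes l a :: "nat \<Rightarrow> 'a :: field"
  assumes inj: "inj_on l {..<n}" and z: "\<And>k. k < n \<Longrightarrow> (\<Sum>j<n. a j * l j ^ k) = 0" and j: "j < n"
  shows "a j = 0"
proof -
  \<comment> \<open>Testing against a multiple of the \<open>j\<close>-th Lagrange polynomial isolates \<open>a j\<close>.\<close>
  define p where "p = (\<Prod>i\<in>{..<n} - {j}. [:- l i, 1:])"
  have "degree p = card ({..<n} - {j})"
    unfolding p_def by (subst degree_prod_eq_sum_degree) auto
  then have deg: "degree p < n" using j by simp
  have p: "poly p x = (\<Sum>k<n. coeff p k * x ^ k)" for x
    unfolding poly_altdef using deg by (intro sum.mono_neutral_left) (auto intro: coeff_eq_0)
  have "(\<Sum>i<n. a i * poly p (l i)) = (\<Sum>k<n. coeff p k * (\<Sum>i<n. a i * l i ^ k))"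
    unfolding p sum_distrib_left by (subst sum.swap) (simp add: mult_ac)
  also have "\<dots> = 0" using z by simp
  also have "(\<Sum>i<n. a i * poly p (l i)) = (\<Sum>i\<in>{j}. a i * poly p (l i))"
    using j by (intro sum.mono_neutral_right) (auto simp: p_def poly_prod)
  finally show ?thesis
    using inj j by (auto simp: p_def poly_prod inj_on_def)
qed

text \<open>Moving \<open>A\<close> across the product evaluates the same number as \<open>a\<close>
  times and as \<open>b\<close> times \<open>u \<bullet> v\<close>.\<close>

lemma symmetric_eigenvectors_orthogonal:
  fixes A :: "real mat"
  assumes A: "A \<in> carrier_mat n n" and sym: "A\<^sup>T = A"
    and u: "eigenvector A u a" and v: "eigenvector A v b" and "a \<noteq> b"
  shows "u \<bullet> v = 0"
proof -
  have c: "u \<in> carrier_vec n" "v \<in> carrier_vec n"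
    and e: "A *\<^sub>v u = a \<cdot>\<^sub>v u" "A *\<^sub>v v = b \<cdot>\<^sub>v v"
    using u v A by (auto simp: eigenvector_def)
  have "a * (u \<bullet> v) = b * (u \<bullet> v)"
    using transpose_vec_mult_scalar[OF A c(2,1)] c by (simp add: sym e)
  then show ?thesis using \<open>a \<noteq> b\<close> by simp
qed

text \<open>An eigenvector orthogonal to all columns of \<open>B\<close> stays so under powers of
  \<open>A\<close>, hence is unobservable. Conversely, the distinct eigenvalues separate the
  components of an unobservable vector in the eigenbasis.\<close>

lemma unobservable_trivial_iff_eigenvectors:
  fixes A :: "real mat"
  assumes A: "A \<in> carrier_mat n n" and sym: "A\<^sup>T = A" and B: "B \<in> carrier_mat n m"
    and ev: "\<And>j. j < n \<Longrightarrow> eigenvector A (u j) (l j)" and inj: "inj_on l {..<n}"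
  shows "(\<forall>x\<in>carrier_vec n. unobservable_vec A B x \<longrightarrow> x = 0\<^sub>v n) \<longleftrightarrow>
    (\<forall>j<n. \<exists>c<m. col B c \<bullet> u j \<noteq> 0)"
proof (intro iffI allI impI ballI)
  fix j assume triv: "\<forall>x\<in>carrier_vec n. unobservable_vec A B x \<longrightarrow> x = 0\<^sub>v n" and j: "j < n"
  show "\<exists>c<m. col B c \<bullet> u j \<noteq> 0"
  proof (rule ccontr)
    assume "\<not> ?thesis"
    moreover have u: "u j \<in> carrier_vec n" "u j \<noteq> 0\<^sub>v n"
      using ev[OF j] A by (auto simp: eigenvector_def)
    ultimately have "unobservable_vec A B (u j)"
      using B by (auto simp: unobservable_vec_def eigenvector_pow[OF A ev[OF j]])
    then show False using triv u by blast
  qed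
next
  fix x assume obs: "\<forall>j<n. \<exists>c<m. col B c \<bullet> u j \<noteq> 0"
    and x: "x \<in> carrier_vec n" and ux: "unobservable_vec A B x"
  \<comment> \<open>The columns of \<open>U\<close> are nonzero and pairwise orthogonal, so its Gram
    matrix is diagonal with nonzero determinant and \<open>U\<close> is invertible.\<close>
  define U where "U = mat n n (\<lambda>(r, j). u j $ r)"
  have U: "U \<in> carrier_mat n n" by (simp add: U_def)
  have u: "u j \<in> carrier_vec n" "u j \<noteq> 0\<^sub>v n" if "j < n" for j
    using ev[OF that] A by (auto simp: eigenvector_def)
  have col: "col U j = u j" if "j < n" for j
    using u[OF that] that by (intro eq_vecI) (auto simp: U_def)
  have "U\<^sup>T * U = mat_diag n (\<lambda>j. u j \<bullet> u j)"
  proof (rule eq_matI)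
    fix i j assume "i < dim_row (mat_diag n (\<lambda>j. u j \<bullet> u j))"
      and "j < dim_col (mat_diag n (\<lambda>j. u j \<bullet> u j))"
    then have ij: "i < n" "j < n" by (auto simp: mat_diag_def)
    have "u i \<bullet> u j = 0" if "i \<noteq> j"
      using symmetric_eigenvectors_orthogonal[OF A sym ev ev, of i j] ij inj that
      by (auto simp: inj_on_def)
    then show "(U\<^sup>T * U) $$ (i, j) = mat_diag n (\<lambda>j. u j \<bullet> u j) $$ (i, j)"
      using ij U by (auto simp: col mat_diag_def)
  qed (use U in \<open>auto simp: mat_diag_def\<close>)
  then have "det U\<^sup>T * det U = det (mat_diag n (\<lambda>j. u j \<bullet> u j))"
    using det_mult[of "U\<^sup>T" n U] U by simp
  also have "\<dots> = (\<Prod>j<n. u j \<bullet> u j)"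
    by (subst det_upper_triangular[of _ n])
      (auto simp: mat_diag_def upper_triangular_def diag_mat_def prod.list_conv_set_nth
        atLeast0LessThan)
  also have "\<dots> \<noteq> 0"
    using u real_scalar_prod_self_eq_0_iff by auto
  finally have "det U \<noteq> 0" by auto
  then obtain V where V: "V \<in> carrier_mat n n" "U * V = 1\<^sub>m n"
    using det_non_zero_imp_unit[OF U, where b="()"] by (auto simp: Units_def ring_mat_def)
  define d where "d = V *\<^sub>v x"
  have d: "d \<in> carrier_vec n" using V x by (simp add: d_def)
  have xd: "x = U *\<^sub>v d"
    unfolding d_def using assoc_mult_mat_vec[OF U V(1) x] V(2) x by simp
  \<comment> \<open>Each output \<open>b \<bullet> (A ^\<^sub>m k *\<^sub>v x)\<close> is a power
    sum in the eigenvalues, with weights \<open>d $ j * (b \<bullet> u j)\<close>.\<close>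
  have expand: "(\<Sum>j<n. (d $ j * (b \<bullet> u j)) * l j ^ k) = b \<bullet> (A ^\<^sub>m k *\<^sub>v x)"
    if b: "b \<in> carrier_vec n" for b k
  proof -
    define P where "P = A ^\<^sub>m k"
    have P: "P \<in> carrier_mat n n" using A by (simp add: P_def)
    have PU: "P * U \<in> carrier_mat n n" using P U by simp
    have cPU: "col (P * U) j = l j ^ k \<cdot>\<^sub>v u j" if "j < n" for j
    proof -
      have "P *\<^sub>v u j = l j ^ k \<cdot>\<^sub>v u j"
        unfolding P_def by (rule eigenvector_pow[OF A ev[OF that]])
      then show ?thesis unfolding col_mult2[OF P U that] col[OF that] .
    qed
    have "b \<bullet> (P *\<^sub>v x) = b \<bullet> ((P * U) *\<^sub>v d)"
      unfolding xd using P U d by simp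
    also have "\<dots> = ((P * U)\<^sup>T *\<^sub>v b) \<bullet> d"
      by (rule transpose_vec_mult_scalar[OF PU d b, symmetric])
    also have "\<dots> = (\<Sum>j<n. (row (P * U)\<^sup>T j \<bullet> b) * d $ j)"
      using P U d unfolding scalar_prod_def[of _ d] by (simp add: atLeast0LessThan)
    also have "\<dots> = (\<Sum>j<n. (d $ j * (b \<bullet> u j)) * l j ^ k)"
    proof (rule sum.cong)
      fix j assume j: "j \<in> {..<n}"
      have "row (P * U)\<^sup>T j = l j ^ k \<cdot>\<^sub>v u j" using j U cPU by simp
      then show "(row (P * U)\<^sup>T j \<bullet> b) * d $ j = (d $ j * (b \<bullet> u j)) * l j ^ k"
        using comm_scalar_prod[OF b u(1), of j] b u(1)[of j] j by simp
    qed simp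
    finally show ?thesis by (simp add: P_def)
  qed
  have "d $ j = 0" if j: "j < n" for j
  proof -
    obtain c where c: "c < m" "col B c \<bullet> u j \<noteq> 0" using obs j by auto
    have b: "col B c \<in> carrier_vec n" using B c by auto
    have "d $ j * (col B c \<bullet> u j) = 0"
      using inj _ j
    proof (rule power_sums_eq_0_imp)
      show "(\<Sum>j<n. d $ j * (col B c \<bullet> u j) * l j ^ k) = 0" if "k < n" for k
        using expand[OF b] ux A B c that by (simp add: unobservable_vec_def)
    qed
    then show ?thesis using c by simp
  qed
  then have "d = 0\<^sub>v n" using d by (intro eq_vecI) auto
  then show "x = 0\<^sub>v n" using xd U by (auto intro!: eq_vecI)
qed

section \<open>Graph Laplacians\<close>

definition node_vec :: "'a fin_graph \<Rightarrow> ('a \<Rightarrow> real) \<Rightarrow> real vec" where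
  "node_vec G f = vec (num_nodes G) (\<lambda>r. f (nodes G ! r))"

text \<open>This is \<open>D - A\<close> in difference form: the degree counts the copies of
  \<open>f v\<close>.\<close>

definition laplace_op :: "'a fin_graph \<Rightarrow> ('a \<Rightarrow> real) \<Rightarrow> 'a \<Rightarrow> real" where
  "laplace_op G f v = (\<Sum>w | w \<in> set (nodes G) \<and> adj G v w. f v - f w)"

lemma laplacian_carrier: "laplacian G \<in> carrier_mat (num_nodes G) (num_nodes G)"
  by (simp add: laplacian_def degree_matrix_def adjacency_matrix_def minus_carrier_mat)

lemma laplacian_symmetric:
  assumes "\<And>v w. adj G v w \<longleftrightarrow> adj G w v"
  shows "(laplacian G)\<^sup>T = laplacian G"
  using assms
  by (intro eq_matI) (auto simp: laplacian_def degree_matrix_def adjacency_matrix_def mat_diag_def)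

lemma sum_nodes:
  assumes "distinct (nodes G)"
  shows "(\<Sum>r<num_nodes G. g (nodes G ! r)) = sum g (set (nodes G))"
  using sum.reindex_bij_betw[OF bij_betw_nth[OF assms refl refl], of g]
  by (simp add: num_nodes_def)

lemma laplacian_mult_node_vec:
  assumes "distinct (nodes G)"
  shows "laplacian G *\<^sub>v node_vec G f = node_vec G (laplace_op G f)"
proof (rule eq_vecI)
  fix r assume "r < dim_vec (node_vec G (laplace_op G f))"
  then have r: "r < num_nodes G" by (simp add: node_vec_def)
  let ?v = "nodes G ! r" and ?N = "{w. w \<in> set (nodes G) \<and> adj G (nodes G ! r) w}"
  have "(laplacian G *\<^sub>v node_vec G f) $ r = (\<Sum>c<num_nodes G. laplacian G $$ (r, c) * f (nodes G ! c))"
    using r laplacian_carrier[of G] by (simp add: scalar_prod_def node_vec_def atLeast0LessThan)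
  also have "\<dots> = (\<Sum>c<num_nodes G. (if c = r then degree_of G ?v * f ?v else 0)
      - (if adj G ?v (nodes G ! c) then f (nodes G ! c) else 0))"
    using r by (intro sum.cong)
      (auto simp: laplacian_def degree_matrix_def adjacency_matrix_def mat_diag_def algebra_simps)
  also have "\<dots> = degree_of G ?v * f ?v - (\<Sum>w\<in>set (nodes G). if adj G ?v w then f w else 0)"
    using r by (simp add: sum_subtractf sum_nodes[OF assms, of "\<lambda>w. if adj G ?v w then f w else 0"])
  also have "\<dots> = degree_of G ?v * f ?v - (\<Sum>w\<in>?N. f w)"
    by (simp add: sum.inter_filter)
  also have "\<dots> = laplace_op G f ?v"
    by (simp add: laplace_op_def sum_subtractf degree_of_def)
  finally show "(laplacian G *\<^sub>v node_vec G f) $ r = node_vec G (laplace_op G f) $ r"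
    using r by (simp add: node_vec_def)
qed (use laplacian_carrier[of G] in \<open>simp add: node_vec_def\<close>)

definition graph_eigenfunction :: "'a fin_graph \<Rightarrow> ('a \<Rightarrow> real) \<Rightarrow> real \<Rightarrow> bool" where
  "graph_eigenfunction G f l \<longleftrightarrow> (\<exists>v\<in>set (nodes G). f v \<noteq> 0) \<and>
     (\<forall>v\<in>set (nodes G). laplace_op G f v = l * f v)"

lemma eigenvector_laplacian:
  assumes "distinct (nodes G)" and "graph_eigenfunction G f l"
  shows "eigenvector (laplacian G) (node_vec G f) l"
proof -
  obtain r where "r < num_nodes G" "f (nodes G ! r) \<noteq> 0"
    using assms(2) by (auto simp: graph_eigenfunction_def num_nodes_def in_set_conv_nth)
  then have "node_vec G f $ r \<noteq> 0\<^sub>v (num_nodes G) $ r" by (simp add: node_vec_def)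
  then have "node_vec G f \<noteq> 0\<^sub>v (num_nodes G)" by metis
  moreover have "node_vec G (laplace_op G f) = l \<cdot>\<^sub>v node_vec G f"
    using assms(2) by (intro eq_vecI) (auto simp: node_vec_def graph_eigenfunction_def num_nodes_def)
  ultimately show ?thesis
    using laplacian_carrier[of G]
    by (simp add: eigenvector_def laplacian_mult_node_vec[OF assms(1)]) (simp add: node_vec_def)
qed

section \<open>The eigenfunction test at the selected nodes\<close>

text \<open>The column is a unit vector, as the nodes are distinct; columns are numbered from 0 but
  selected nodes from 1.\<close>

lemma col_node_matrix_scalar_prod:
  assumes "distinct (nodes G)" and "c < m" and "i (c + 1) \<in> set (nodes G)"
  shows "col (node_matrix G m i) c \<bullet> node_vec G f = f (i (c + 1))"
proof -
  have "col (node_matrix G m i) c \<bullet> node_vec G f =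
      (\<Sum>r<num_nodes G. (if nodes G ! r = i (c + 1) then 1 else 0) * f (nodes G ! r))"
    using assms(2) by (simp add: scalar_prod_def node_vec_def node_matrix_def atLeast0LessThan)
  also have "\<dots> = (\<Sum>v\<in>set (nodes G). (if v = i (c + 1) then 1 else 0) * f v)"
    by (rule sum_nodes[OF assms(1)])
  also have "\<dots> = (\<Sum>v\<in>set (nodes G). if v = i (c + 1) then f v else 0)"
    by (intro sum.cong) auto
  finally show ?thesis using assms(3) by simp
qed

text \<open>The eigenvector test in terms of functions. An arbitrary index set \<open>J\<close>
  allows pairs of mode numbers as indices; its size and the distinct eigenvalues make the
  eigenvectors a basis.\<close>

lemma controllable_observable_from_iff:
  fixes f :: "'j \<Rightarrow> 'a \<Rightarrow> real" and l :: "'j \<Rightarrow> real"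
  assumes dist: "distinct (nodes G)" and sym: "\<And>v w. adj G v w \<longleftrightarrow> adj G w v"
    and J: "finite J" "card J = num_nodes G"
    and eig: "\<And>j. j \<in> J \<Longrightarrow> graph_eigenfunction G (f j) (l j)" and inj: "inj_on l J"
    and i: "i ` {1..m} \<subseteq> set (nodes G)"
  shows "controllable_from G m i \<longleftrightarrow> (\<forall>j\<in>J. \<exists>\<alpha>\<in>{1..m}. f j (i \<alpha>) \<noteq> 0)"
    and "observable_from G m i \<longleftrightarrow> (\<forall>j\<in>J. \<exists>\<alpha>\<in>{1..m}. f j (i \<alpha>) \<noteq> 0)"
proof -
  let ?n = "num_nodes G" and ?B = "node_matrix G m i"
  obtain h where h: "bij_betw h {..<?n} J"
    using ex_bij_betw_nat_finite[OF J(1)] J(2) by (auto simp: atLeast0LessThan)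
  have B: "?B \<in> carrier_mat ?n m" by (simp add: node_matrix_def)
  have ev: "eigenvector (laplacian G) (node_vec G (f (h j))) (l (h j))" if "j < ?n" for j
    using h that by (intro eigenvector_laplacian[OF dist] eig) (auto simp: bij_betw_def)
  have "inj_on (l \<circ> h) {..<?n}"
    using h inj by (intro comp_inj_on) (auto simp: bij_betw_def)
  then have injh: "inj_on (\<lambda>j. l (h j)) {..<?n}" by (simp add: comp_def)
  have "(\<forall>x\<in>carrier_vec ?n. unobservable_vec (laplacian G) ?B x \<longrightarrow> x = 0\<^sub>v ?n) \<longleftrightarrow>
      (\<forall>j<?n. \<exists>c<m. col ?B c \<bullet> node_vec G (f (h j)) \<noteq> 0)"
    by (rule unobservable_trivial_iff_eigenvectors[OF laplacian_carrier laplacian_symmetric[OF sym] B ev injh])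
  also have "\<dots> \<longleftrightarrow> (\<forall>j<?n. \<exists>c<m. f (h j) (i (Suc c)) \<noteq> 0)"
  proof -
    have "col ?B c \<bullet> node_vec G g = g (i (Suc c))" if "c < m" for c g
      using col_node_matrix_scalar_prod[OF dist that, of i g] i that by (force simp: image_subset_iff)
    then show ?thesis by (simp cong: conj_cong)
  qed
  also have "\<dots> \<longleftrightarrow> (\<forall>j<?n. \<exists>\<alpha>\<in>{1..m}. f (h j) (i \<alpha>) \<noteq> 0)"
  proof -
    have "{1..m} = Suc ` {..<m}" by (auto simp: image_Suc_lessThan)
    then show ?thesis by auto
  qed
  also have "\<dots> \<longleftrightarrow> (\<forall>j\<in>J. \<exists>\<alpha>\<in>{1..m}. f j (i \<alpha>) \<noteq> 0)"
    using h by (auto simp: bij_betw_def)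
  finally have *: "(\<forall>x\<in>carrier_vec ?n. unobservable_vec (laplacian G) ?B x \<longrightarrow> x = 0\<^sub>v ?n) \<longleftrightarrow>
      (\<forall>j\<in>J. \<exists>\<alpha>\<in>{1..m}. f j (i \<alpha>) \<noteq> 0)" .
  show "controllable_from G m i \<longleftrightarrow> (\<forall>j\<in>J. \<exists>\<alpha>\<in>{1..m}. f j (i \<alpha>) \<noteq> 0)"
    using controllable_pair_iff[OF laplacian_carrier laplacian_symmetric[OF sym] B] *
    by (simp add: controllable_from_def)
  show "observable_from G m i \<longleftrightarrow> (\<forall>j\<in>J. \<exists>\<alpha>\<in>{1..m}. f j (i \<alpha>) \<noteq> 0)"
    using observable_pair_iff[OF laplacian_carrier B] * by (simp add: observable_from_def)
qed

section \<open>Separation of variables on a Cartesian product\<close>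

text \<open>A neighbour arises by a step in one factor; without loops in \<open>G\<close> the two
  kinds of neighbour are disjoint.\<close>

lemma laplace_op_cart_product:
  assumes G: "\<And>u. \<not> adj G u u" and u: "u \<in> set (nodes G)" and v: "v \<in> set (nodes H)"
  shows "laplace_op (G \<box> H) f (u, v) =
    laplace_op G (\<lambda>w. f (w, v)) u + laplace_op H (\<lambda>w. f (u, w)) v"
proof -
  let ?NG = "{w. w \<in> set (nodes G) \<and> adj G u w}" and ?NH = "{w. w \<in> set (nodes H) \<and> adj H v w}"
  have N: "{x. x \<in> set (nodes (G \<box> H)) \<and> adj (G \<box> H) (u, v) x} =
      (\<lambda>w. (w, v)) ` ?NG \<union> (\<lambda>w. (u, w)) ` ?NH"
    using u v by (auto simp: cart_product_def)
  have "(\<lambda>w. (w, v)) ` ?NG \<inter> (\<lambda>w. (u, w)) ` ?NH = {}"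
    using G by auto
  then show ?thesis
    unfolding laplace_op_def N
    by (subst sum.union_disjoint) (auto simp: sum.reindex inj_on_def)
qed

text \<open>Each factor operator treats the function of the other coordinate as a constant, so the
  eigenvalues add.\<close>

lemma graph_eigenfunction_cart_product:
  assumes "\<And>u. \<not> adj G u u" and "graph_eigenfunction G f a" and "graph_eigenfunction H g b"
  shows "graph_eigenfunction (G \<box> H) (\<lambda>(u, v). f u * g v) (a + b)"
proof -
  have nodes: "set (nodes (G \<box> H)) = set (nodes G) \<times> set (nodes H)"
    by (simp add: cart_product_def)
  have lin: "laplace_op G (\<lambda>w. f w * c) u = laplace_op G f u * c"
      "laplace_op H (\<lambda>w. c * g w) v = c * laplace_op H g v" for u v c
    by (simp_all add: laplace_op_def sum_distrib_left sum_distrib_right left_diff_distrib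
        right_diff_distrib)
  have "laplace_op (G \<box> H) (\<lambda>(u, v). f u * g v) (u, v) = (a + b) * (f u * g v)"
    if "u \<in> set (nodes G)" "v \<in> set (nodes H)" for u v
    using assms(2,3) that
    by (simp add: laplace_op_cart_product[OF assms(1)] lin graph_eigenfunction_def distrib_right)
  moreover obtain u v where "u \<in> set (nodes G)" "f u \<noteq> 0" "v \<in> set (nodes H)" "g v \<noteq> 0"
    using assms(2,3) by (auto simp: graph_eigenfunction_def)
  ultimately show ?thesis
    unfolding graph_eigenfunction_def nodes by auto
qed

section \<open>Cosine eigenfunctions of paths\<close>

text \<open>The values at the fictitious vertices \<open>0\<close> and \<open>n + 1\<close> repeat those at \<open>1\<close> and \<open>n\<close>,
  so the three-term recurrence of the cosine remains valid at the two ends.\<close>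

definition path_mode :: "nat \<Rightarrow> nat \<Rightarrow> nat \<Rightarrow> real" where
  "path_mode n k j = cos (pi * real k * (2 * real j - 1) / (2 * real n))"

definition path_eigenvalue :: "nat \<Rightarrow> nat \<Rightarrow> real" where
  "path_eigenvalue n k = 2 - 2 * cos (pi * real k / real n)"

lemma path_mode_0: "path_mode n k 0 = path_mode n k 1"
  by (simp add: path_mode_def)

text \<open>The arguments at \<open>n\<close> and \<open>n + 1\<close> are symmetric about
  \<open>k * pi\<close>, and so is the cosine.\<close>

lemma path_mode_Suc:
  assumes "n > 0"
  shows "path_mode n k (Suc n) = path_mode n k n"
proof -
  let ?t = "pi * real k / (2 * real n)"
  have "pi * real k * (2 * real (Suc n) - 1) / (2 * real n) = real k * pi + ?t"
    and "pi * real k * (2 * real n - 1) / (2 * real n) = real k * pi - ?t"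
    using assms by (simp_all add: field_simps)
  then show ?thesis
    by (simp add: path_mode_def cos_add cos_diff sin_npi)
qed

text \<open>This is \<open>cos (x - d) + cos (x + d) = 2 * cos x * cos d\<close>, where
  \<open>d\<close> is the phase step between neighbouring vertices.\<close>

lemma path_mode_recurrence:
  assumes "n > 0"
  shows "2 * path_mode n k (Suc j) - path_mode n k j - path_mode n k (Suc (Suc j)) =
    path_eigenvalue n k * path_mode n k (Suc j)"
proof -
  define x d where "x = pi * real k * (2 * real (Suc j) - 1) / (2 * real n)"
    and "d = pi * real k / real n"
  have "path_mode n k (Suc j) = cos x"
    by (simp add: path_mode_def x_def)
  moreover have "path_mode n k j = cos (x - d)" "path_mode n k (Suc (Suc j)) = cos (x + d)"
    unfolding path_mode_def x_def d_def
    by (rule arg_cong[of _ _ cos], use assms in \<open>simp add: field_simps\<close>)+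
  ultimately show ?thesis
    by (simp add: path_eigenvalue_def d_def[symmetric] cos_add cos_diff left_diff_distrib)
qed

lemma set_nodes_path_graph: "set (nodes (path_graph n)) = {1..n}"
  by (auto simp: path_graph_def)

lemma graph_eigenfunction_path:
  assumes k: "k < n"
  shows "graph_eigenfunction (path_graph n) (path_mode n k) (path_eigenvalue n k)"
  unfolding graph_eigenfunction_def set_nodes_path_graph
proof (intro conjI ballI)
  \<comment> \<open>At vertex 1 the phase lies in \<open>[0, pi / 2)\<close>, so no mode vanishes
    there.\<close>
  have "0 \<le> pi * real k / (2 * real n)" by simp
  then have "- (pi / 2) < pi * real k / (2 * real n)" using pi_gt_zero by linarith
  moreover have "pi * real k / (2 * real n) < pi / 2"
    using k by (simp add: field_simps)
  ultimately have "path_mode n k 1 > 0"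
    unfolding path_mode_def by (simp add: cos_gt_zero_pi)
  then show "\<exists>v\<in>{1..n}. path_mode n k v \<noteq> 0"
    using k by (intro bexI[of _ 1]) auto
next
  fix v assume v: "v \<in> {1..n}"
  then obtain j where j: "v = Suc j" by (cases v) auto
  let ?c = "path_mode n k"
  have N: "{w. w \<in> {1..n} \<and> adj (path_graph n) v w} =
      (if j > 0 then {j} else {}) \<union> (if v < n then {Suc v} else {})"
    using v j by (auto simp: path_graph_def)
  have "laplace_op (path_graph n) ?c v =
      (if j > 0 then ?c v - ?c j else 0) + (if v < n then ?c v - ?c (Suc v) else 0)"
    unfolding laplace_op_def set_nodes_path_graph N
    by (subst sum.union_disjoint) (auto simp: j)
  \<comment> \<open>A missing neighbour at an end is replaced by a fictitious one of equal value,
    which adds 0.\<close>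
  also have "\<dots> = (?c v - ?c j) + (?c v - ?c (Suc v))"
  proof -
    have "?c v = ?c j" if "j = 0" using that path_mode_0 by (simp add: j)
    moreover have "?c v = ?c (Suc v)" if "\<not> v < n"
      using that v path_mode_Suc[of n k] by (auto simp: not_less le_antisym)
    ultimately show ?thesis by auto
  qed
  also have "\<dots> = path_eigenvalue n k * ?c v"
    using path_mode_recurrence[of n k j] k by (simp add: j)
  finally show "laplace_op (path_graph n) ?c v = path_eigenvalue n k * ?c v" .
qed

text \<open>The phases lie in \<open>[0, pi]\<close>, where the cosine is injective.\<close>

lemma inj_on_path_eigenvalue: "inj_on (path_eigenvalue n) {..<n}"
proof (rule inj_onI)
  fix k l assume kl: "k \<in> {..<n}" "l \<in> {..<n}" "path_eigenvalue n k = path_eigenvalue n l"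
  have range: "0 \<le> pi * real x / real n" "pi * real x / real n \<le> pi" if "x < n" for x
    using that by (simp_all add: field_simps)
  have "cos (pi * real k / real n) = cos (pi * real l / real n)"
    using kl(3) by (simp add: path_eigenvalue_def)
  then have "pi * real k / real n = pi * real l / real n"
    by (rule cos_inj_pi[rotated 4]) (use kl(1,2) range in simp_all)
  then show "k = l" using kl(1) by (simp add: divide_cancel_right)
qed

section \<open>Zeros of modes and divisibility\<close>

text \<open>The cosine vanishes exactly at the odd multiples of \<open>pi / 2\<close>; clearing
  denominators leaves an integer equation. Integers keep \<open>2 * j - 1\<close> odd even at
  \<open>j = 0\<close>.\<close>

lemma path_mode_eq_0_iff:
  assumes "n > 0"
  shows "path_mode n k j = 0 \<longleftrightarrow> (\<exists>z. odd z \<and> int k * (2 * int j - 1) = int n * z)"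
proof -
  have "pi * real k * (2 * real j - 1) / (2 * real n) = of_int z * (pi / 2) \<longleftrightarrow>
      int k * (2 * int j - 1) = int n * z" for z
  proof -
    have "pi * real k * (2 * real j - 1) / (2 * real n) =
        (real k * (2 * real j - 1) / real n) * (pi / 2)" by (simp add: mult_ac)
    then have "pi * real k * (2 * real j - 1) / (2 * real n) = of_int z * (pi / 2) \<longleftrightarrow>
        real k * (2 * real j - 1) / real n = of_int z" by (simp del: times_divide_eq_left)
    also have "\<dots> \<longleftrightarrow> real k * (2 * real j - 1) = real n * of_int z"
      using assms by (simp add: divide_eq_eq mult.commute)
    also have "\<dots> \<longleftrightarrow> real_of_int (int k * (2 * int j - 1)) = of_int (int n * z)"
      by simp
    finally show ?thesis by (simp only: of_int_eq_iff)
  qed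
  then show ?thesis
    unfolding path_mode_def cos_zero_iff_int by simp
qed

text \<open>The two sides of the congruence differ by \<open>n - (2 * j - 1)\<close>, and
  \<open>p\<close> divides \<open>n\<close>.\<close>

lemma prime_condition_iff:
  assumes "p dvd n"
  shows "prime_condition n j p \<longleftrightarrow> int p dvd 2 * int j - 1"
proof -
  have "int n - int j - (int j - 1) = int n - (2 * int j - 1)" by simp
  moreover have "int p dvd int n" using assms by simp
  ultimately show ?thesis
    unfolding prime_condition_def cong_iff_dvd_diff by (metis dvd_diff_right_iff)
qed

text \<open>If \<open>2 * j - 1 = p * z\<close>, then \<open>z\<close> is odd as a factor of an odd
  number, and \<open>(n div p) * (2 * j - 1) = n * z\<close>.\<close>

lemma path_mode_div_eq_0:
  assumes "n > 0" and "p dvd n" and "prime_condition n j p"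
  shows "path_mode n (n div p) j = 0"
proof -
  obtain z where z: "2 * int j - 1 = int p * z"
    using assms prime_condition_iff unfolding dvd_def by blast
  have "odd (2 * int j - 1)" by simp
  then have "odd z" unfolding z by simp
  moreover have "int (n div p) * (int p * z) = int n * z"
    using assms(2) by (simp add: mult.assoc[symmetric] of_nat_mult[symmetric] del: of_nat_mult)
  ultimately show ?thesis
    using assms(1) z by (auto simp: path_mode_eq_0_iff)
qed

text \<open>If mode \<open>k\<close> vanishes at \<open>j\<close> then \<open>n / gcd k n\<close>, which exceeds \<open>1\<close> and depends on \<open>k\<close>
  only, divides the odd number \<open>2 j - 1\<close>; any of its prime factors serves as \<open>p\<close>. The prime
  \<open>q\<close> is only needed for a mode that vanishes nowhere.\<close>

lemma ex_prime_condition_of_path_mode_zeros: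
  assumes k: "k < n" and q: "prime q" "odd q" "q dvd n"
  obtains p where "prime p" "odd p" "p dvd n"
    "\<And>j. path_mode n k j = 0 \<Longrightarrow> prime_condition n j p"
proof (cases "\<exists>j. path_mode n k j = 0")
  case False
  then show ?thesis using that[OF q] by blast
next
  case True
  then obtain j0 where j0: "path_mode n k j0 = 0" by blast
  define g where "g = gcd k n"
  have g: "g > 0" using k by (auto simp: g_def)
  \<comment> \<open>Cancelling the gcd gives \<open>k' * (2 * j - 1) = n' * z\<close> at a zero
    \<open>j\<close>, and coprimality leaves \<open>n'\<close> dividing
    \<open>2 * j - 1\<close>.\<close>
  obtain k' n' where kn: "k = k' * g" "n = n' * g" "coprime k' n'"
    using gcd_coprime_exists[of k n] g unfolding g_def by blast
  have dvd: "int n' dvd 2 * int j - 1" if "path_mode n k j = 0" for j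
  proof -
    from \<open>path_mode n k j = 0\<close> obtain z where "int k * (2 * int j - 1) = int n * z"
      using k path_mode_eq_0_iff[of n k j] by auto
    then have "int g * (int k' * (2 * int j - 1)) = int g * (int n' * z)"
      by (simp add: kn(1,2) mult_ac)
    then have "int k' * (2 * int j - 1) = int n' * z" using g by simp
    then have "int n' dvd int k' * (2 * int j - 1)" by simp
    then show ?thesis using kn(3) by (simp add: coprime_dvd_mult_right_iff coprime_commute)
  qed
  \<comment> \<open>\<open>n' = 1\<close> would force \<open>k = 0\<close>, whose mode is constantly
    1.\<close>
  have "n' \<noteq> 1"
  proof
    assume "n' = 1"
    then have "n dvd k" using kn by simp
    then have "k = 0" using k by (cases "k = 0") (auto dest: dvd_imp_le)
    then show False using j0 by (simp add: path_mode_def)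
  qed
  then obtain p where p: "prime p" "p dvd n'" using prime_factor_nat by blast
  then have pd: "int p dvd 2 * int j - 1" if "path_mode n k j = 0" for j
    using dvd[OF that] by (meson dvd_trans of_nat_dvd_iff)
  have "p dvd n" using p kn by simp
  moreover have "odd p"
  proof
    assume "even p"
    then have "even (int p)" by simp
    then have "even (2 * int j0 - 1)" using pd[OF j0] dvd_trans by blast
    then show False by simp
  qed
  ultimately show ?thesis
    using that p pd prime_condition_iff by blast
qed

text \<open>Turns an odd prime factor of a path length back into one of the listed primes.\<close>

lemma odd_prime_dvd_product:
  assumes "prime p" and "odd p" and "p dvd 2 ^ e * (\<Prod>\<nu>\<in>{1..k}. q \<nu>)"
    and "\<And>\<nu>. \<nu> \<in> {1..k::nat} \<Longrightarrow> prime (q \<nu> :: nat)"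
  obtains \<nu> where "\<nu> \<in> {1..k}" "p = q \<nu>"
proof -
  have "\<not> p dvd 2 ^ e"
    using assms(1,2) by (metis prime_dvd_power primes_dvd_imp_eq two_is_prime_nat)
  then obtain \<nu> where "\<nu> \<in> {1..k}" "p dvd q \<nu>"
    using assms(1,3) by (auto simp: prime_dvd_mult_iff prime_dvd_prod_iff)
  then show ?thesis
    using that assms(1,4) primes_dvd_imp_eq by blast
qed

section \<open>Controllability and observability of the simple grid\<close>

theorem mainTheorem2:
  fixes n1 n2 e1 e2 k1 k2 m :: nat
    and p1 p2 :: "nat \<Rightarrow> nat"
    and i :: "nat \<Rightarrow> nat \<times> nat"
  assumes "k1 \<ge> 1" and "k2 \<ge> 1"
    and "\<And>\<nu>. \<nu> \<in> {1..k1} \<Longrightarrow> prime (p1 \<nu>) \<and> odd (p1 \<nu>)"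
    and "\<And>\<mu>. \<mu> \<in> {1..k2} \<Longrightarrow> prime (p2 \<mu>) \<and> odd (p2 \<mu>)"
    and "n1 = 2 ^ e1 * (\<Prod>\<nu>\<in>{1..k1}. p1 \<nu>)"
    and "n2 = 2 ^ e2 * (\<Prod>\<mu>\<in>{1..k2}. p2 \<mu>)"
    and "simple_grid n1 n2"
    and "m \<ge> 1" and "inj_on i {1..m}"
    and "i ` {1..m} \<subseteq> set (nodes (path_graph n1 \<box> path_graph n2))"
  shows "(controllable_from (path_graph n1 \<box> path_graph n2) m i \<longleftrightarrow>
            (\<Inter>\<alpha>\<in>{1..m}. partition_block n1 n2 k1 k2 p1 p2 (i \<alpha>)) = {})
       \<and> (observable_from (path_graph n1 \<box> path_graph n2) m i \<longleftrightarrow>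
            (\<Inter>\<alpha>\<in>{1..m}. partition_block n1 n2 k1 k2 p1 p2 (i \<alpha>)) = {})"
proof -
  let ?G = "path_graph n1 \<box> path_graph n2" and ?J = "{..<n1} \<times> {..<n2}"
  let ?f = "\<lambda>(k, l) (u, v). path_mode n1 k u * path_mode n2 l v"
  let ?ev = "\<lambda>(k, l). path_eigenvalue n1 k + path_eigenvalue n2 l"
  let ?O = "\<Inter>\<alpha>\<in>{1..m}. partition_block n1 n2 k1 k2 p1 p2 (i \<alpha>)"
  have pos: "n1 > 0" "n2 > 0"
    using assms(3-6) by (auto intro!: prod_pos prime_gt_0_nat)
  have dvd1: "p1 \<nu> dvd n1" if "\<nu> \<in> {1..k1}" for \<nu>
    unfolding assms(5) using that by (intro dvd_mult dvd_prodI) auto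
  have dvd2: "p2 \<mu> dvd n2" if "\<mu> \<in> {1..k2}" for \<mu>
    unfolding assms(6) using that by (intro dvd_mult dvd_prodI) auto
  have spec: "path_eigenvalue n k \<in> spectrum (laplacian (path_graph n))" if "k < n" for n k
    using eigenvector_laplacian[OF _ graph_eigenfunction_path[OF that]]
    by (auto simp: spectrum_def eigenvalue_def path_graph_def)
  \<comment> \<open>Simplicity is stated for spectra; the cosine eigenvalues lie in them, so
    distinct pairs of modes have distinct sums.\<close>
  have inj: "inj_on ?ev ?J"
  proof (rule inj_onI, clarify)
    fix k l k' l' assume b: "k < n1" "l < n2" "k' < n1" "l' < n2"
      and eq: "path_eigenvalue n1 k + path_eigenvalue n2 l =
        path_eigenvalue n1 k' + path_eigenvalue n2 l'"
    have "(path_eigenvalue n1 k, path_eigenvalue n2 l) = (path_eigenvalue n1 k', path_eigenvalue n2 l')"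
      using assms(7)[unfolded simple_grid_def] by (rule inj_onD) (use eq b spec in auto)
    then show "k = k' \<and> l = l'"
      using b inj_on_path_eigenvalue by (auto simp: inj_on_def)
  qed
  have eig: "graph_eigenfunction ?G (?f j) (?ev j)" if "j \<in> ?J" for j
    using that graph_eigenfunction_path
    by (auto intro!: graph_eigenfunction_cart_product simp: path_graph_def)
  have dist: "distinct (nodes ?G)"
    by (simp add: cart_product_def path_graph_def distinct_product)
  have card: "card ?J = num_nodes ?G"
    by (simp add: num_nodes_def cart_product_def path_graph_def)
  have sym: "adj ?G v w \<longleftrightarrow> adj ?G w v" for v w
    by (auto simp: cart_product_def path_graph_def)
  have vis_iff: "(\<forall>j\<in>?J. \<exists>\<alpha>\<in>{1..m}. ?f j (i \<alpha>) \<noteq> 0) \<longleftrightarrow> ?O = {}"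
  proof (intro iffI equals0I ballI)
    fix x assume vis: "\<forall>j\<in>?J. \<exists>\<alpha>\<in>{1..m}. ?f j (i \<alpha>) \<noteq> 0" and x: "x \<in> ?O"
    obtain p q where pq: "x = (p, q)" by fastforce
    \<comment> \<open>As \<open>m \<ge> 1\<close>, the intersection is over a nonempty family, so
      \<open>x\<close> lies in some block and is a pair of listed primes.\<close>
    obtain \<nu> \<mu> where "\<nu> \<in> {1..k1}" "p = p1 \<nu>" "\<mu> \<in> {1..k2}" "q = p2 \<mu>"
      using x assms(8) unfolding pq partition_block_def by force
    then have p: "prime p" "p dvd n1" and q: "prime q" "q dvd n2"
      using assms(3)[of \<nu>] assms(4)[of \<mu>] dvd1[of \<nu>] dvd2[of \<mu>] by blast+
    \<comment> \<open>The product of modes \<open>n1 div p\<close> and \<open>n2 div q\<close> is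
      the one that vanishes at all selected nodes; \<open>p\<close> and \<open>q\<close> exceed 1,
      which keeps it in range.\<close>
    have "(n1 div p, n2 div q) \<in> ?J"
      using pos div_less_dividend[OF prime_gt_1_nat[OF p(1)]]
        div_less_dividend[OF prime_gt_1_nat[OF q(1)]] by blast
    then obtain \<alpha> where \<alpha>: "\<alpha> \<in> {1..m}" "?f (n1 div p, n2 div q) (i \<alpha>) \<noteq> 0"
      using vis by blast
    moreover have "prime_condition n1 (fst (i \<alpha>)) p \<or> prime_condition n2 (snd (i \<alpha>)) q"
      using x \<alpha>(1) unfolding pq partition_block_def by auto
    ultimately show False
      using path_mode_div_eq_0[OF pos(1) p(2)] path_mode_div_eq_0[OF pos(2) q(2)]
      by (auto simp: case_prod_unfold)
  next
    fix j assume empty: "?O = {}" and j: "j \<in> ?J"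
    obtain k l where kl: "j = (k, l)" "k < n1" "l < n2" using j by auto
    show "\<exists>\<alpha>\<in>{1..m}. ?f j (i \<alpha>) \<noteq> 0"
    proof (rule ccontr)
      assume "\<not> ?thesis"
      then have z: "path_mode n1 k (fst (i \<alpha>)) = 0 \<or> path_mode n2 l (snd (i \<alpha>)) = 0"
        if "\<alpha> \<in> {1..m}" for \<alpha>
        using that by (auto simp: kl case_prod_unfold)
      \<comment> \<open>The first listed primes serve as fallback for modes without zeros.\<close>
      have "1 \<in> {1..k1}" "1 \<in> {1..k2}" using assms(1,2) by auto
      then have o: "prime (p1 1)" "odd (p1 1)" "p1 1 dvd n1" "prime (p2 1)" "odd (p2 1)" "p2 1 dvd n2"
        using assms(3)[of 1] assms(4)[of 1] dvd1[of 1] dvd2[of 1] by blast+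
      \<comment> \<open>\<open>p\<close> depends on \<open>k\<close> alone and \<open>q\<close> on
        \<open>l\<close> alone, so one pair \<open>(p, q)\<close> covers all selected nodes at
        once.\<close>
      obtain p where p: "prime p" "odd p" "p dvd n1"
          "\<And>j. path_mode n1 k j = 0 \<Longrightarrow> prime_condition n1 j p"
        using ex_prime_condition_of_path_mode_zeros[OF kl(2) o(1-3)] by blast
      obtain q where q: "prime q" "odd q" "q dvd n2"
          "\<And>j. path_mode n2 l j = 0 \<Longrightarrow> prime_condition n2 j q"
        using ex_prime_condition_of_path_mode_zeros[OF kl(3) o(4-6)] by blast
      obtain \<nu> where \<nu>: "\<nu> \<in> {1..k1}" "p = p1 \<nu>"
        using odd_prime_dvd_product[OF p(1,2) p(3)[unfolded assms(5)]] assms(3) by blast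
      obtain \<mu> where \<mu>: "\<mu> \<in> {1..k2}" "q = p2 \<mu>"
        using odd_prime_dvd_product[OF q(1,2) q(3)[unfolded assms(6)]] assms(4) by blast
      have "(p, q) \<in> partition_block n1 n2 k1 k2 p1 p2 (i \<alpha>)" if "\<alpha> \<in> {1..m}" for \<alpha>
        using \<nu> \<mu> z[OF that] p(4) q(4) unfolding partition_block_def by blast
      then have "(p, q) \<in> ?O" by blast
      then show False using empty by blast
    qed
  qed
  have fin: "finite ?J" by simp
  show ?thesis
    using controllable_observable_from_iff[OF dist sym fin card eig inj assms(10)]
    unfolding vis_iff by blast
qed

end
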